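(* Let $2\le p<\infty$, let $C\subseteq L_p$ and let $T:C\to C$ be a nonexpansive mapping. Suppose that $B_r[q]\subset\mathrm{Fix}(T)$ for some $q\in L_p$ and $r>0$, and suppose that $x\in C$ and $\|x-q\|<K$. Then $$\forall\varepsilon>0\ \forall i\ge f(\varepsilon)\ \left(\|T^{i+1}x-T^ix\|\le\varepsilon\right)$$ where $$f(\varepsilon):=\left\lceil\frac{p\cdot2^{3p+1}\cdot K^{p+2}}{\varepsilon^p\cdot r^2}\right\rceil.$$
   Context: $L_p$ denotes the Banach space $L_p(\mu)$ over a measure space, with its usual norm. $T$ is nonexpansive if $\|Tu-Tv\|\le\|u-v\|$ for all $u,v\in C$. $B_r[q]$ is the closed ball of radius $r$ centred at $q$; $\mathrm{Fix}(T)$ is the set of fixed points of $T$. *)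

theory Defs
  imports "HOL-Analysis.Analysis"
begin

text \<open>
  The space \<open>L\<^sub>p(\<mu>)\<close> depends on the measure \<open>M\<close> and the exponent \<open>p\<close>, so it is an explicit carrier:
  a set of equivalence classes, modulo equality almost everywhere, of \<open>p\<close>-integrable functions.
  The sort \<open>{real_normed_field, euclidean_space}\<close> covers both scalar fields, the reals and the
  complex numbers.
\<close>

definition Lp_funs :: "'a measure \<Rightarrow> real \<Rightarrow> ('a \<Rightarrow> 'b::{real_normed_field, euclidean_space}) set" where
  "Lp_funs M p = {f \<in> borel_measurable M. integrable M (\<lambda>x. norm (f x) powr p)}"

definition Lp_rel :: "'a measure \<Rightarrow> real \<Rightarrow>
    (('a \<Rightarrow> 'b::{real_normed_field, euclidean_space}) \<times> ('a \<Rightarrow> 'b)) set" where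
  "Lp_rel M p = {(f, g). f \<in> Lp_funs M p \<and> g \<in> Lp_funs M p \<and> (AE x in M. f x = g x)}"

definition Lp :: "'a measure \<Rightarrow> real \<Rightarrow> ('a \<Rightarrow> 'b::{real_normed_field, euclidean_space}) set set" where
  "Lp M p = Lp_funs M p // Lp_rel M p"

definition Lp_minus :: "'a measure \<Rightarrow> real \<Rightarrow> ('a \<Rightarrow> 'b::{real_normed_field, euclidean_space}) set \<Rightarrow>
    ('a \<Rightarrow> 'b) set \<Rightarrow> ('a \<Rightarrow> 'b) set" where
  "Lp_minus M p u v = (\<Union>f\<in>u. \<Union>g\<in>v. Lp_rel M p `` {\<lambda>x. f x - g x})"

text \<open>All representatives of a class have the same norm, so the image below is a singleton.\<close>

definition Lp_norm :: "'a measure \<Rightarrow> real \<Rightarrow> ('a \<Rightarrow> 'b::{real_normed_field, euclidean_space}) set \<Rightarrow> real" where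
  "Lp_norm M p u = the_elem ((\<lambda>f. (\<integral>x. norm (f x) powr p \<partial>M) powr (1 / p)) ` u)"

definition Lp_cball :: "'a measure \<Rightarrow> real \<Rightarrow> ('a \<Rightarrow> 'b::{real_normed_field, euclidean_space}) set \<Rightarrow>
    real \<Rightarrow> ('a \<Rightarrow> 'b) set set" where
  "Lp_cball M p q r = {u \<in> Lp M p. Lp_norm M p (Lp_minus M p u q) \<le> r}"

definition nonexpansive_on :: "'a measure \<Rightarrow> real \<Rightarrow>
    ('a \<Rightarrow> 'b::{real_normed_field, euclidean_space}) set set \<Rightarrow>
    (('a \<Rightarrow> 'b) set \<Rightarrow> ('a \<Rightarrow> 'b) set) \<Rightarrow> bool" where
  "nonexpansive_on M p C T \<longleftrightarrow>
     (\<forall>u\<in>C. \<forall>v\<in>C. Lp_norm M p (Lp_minus M p (T u) (T v)) \<le> Lp_norm M p (Lp_minus M p u v))"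

text \<open>\<open>T\<close> is a total function in HOL; only its values on the domain \<open>C\<close> are relevant.\<close>

definition Fix_on :: "'c set \<Rightarrow> ('c \<Rightarrow> 'c) \<Rightarrow> 'c set" where
  "Fix_on C T = {u \<in> C. T u = u}"

lemma equiv_Lp_rel:
  "equiv (Lp_funs M p :: ('a \<Rightarrow> 'b::{real_normed_field, euclidean_space}) set) (Lp_rel M p)"
proof (rule equivI)
  show "Lp_rel M p \<subseteq> Lp_funs M p \<times> (Lp_funs M p :: ('a \<Rightarrow> 'b) set)" by (auto simp: Lp_rel_def)
  show "refl_on (Lp_funs M p :: ('a \<Rightarrow> 'b) set) (Lp_rel M p)" by (auto simp: refl_on_def Lp_rel_def)
  show "sym (Lp_rel M p :: (('a \<Rightarrow> 'b) \<times> ('a \<Rightarrow> 'b)) set)"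
  proof (rule symI)
    fix f g :: "'a \<Rightarrow> 'b" assume fg: "(f, g) \<in> Lp_rel M p"
    then have "AE x in M. f x = g x" by (simp add: Lp_rel_def)
    then have "AE x in M. g x = f x" by eventually_elim simp
    with fg show "(g, f) \<in> Lp_rel M p" by (simp add: Lp_rel_def)
  qed
  show "trans (Lp_rel M p :: (('a \<Rightarrow> 'b) \<times> ('a \<Rightarrow> 'b)) set)"
  proof (rule transI)
    fix f g h :: "'a \<Rightarrow> 'b" assume *: "(f, g) \<in> Lp_rel M p" "(g, h) \<in> Lp_rel M p"
    then have "AE x in M. f x = g x" "AE x in M. g x = h x" by (simp_all add: Lp_rel_def)
    then have "AE x in M. f x = h x" by eventually_elim simp
    with * show "(f, h) \<in> Lp_rel M p" by (simp add: Lp_rel_def)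
  qed
qed

lemma Lp_funs_diff:
  assumes "f \<in> Lp_funs M p" "g \<in> Lp_funs M p" "0 \<le> p"
  shows "(\<lambda>x. f x - g x) \<in> Lp_funs M p"
proof -
  have [measurable]: "f \<in> borel_measurable M" "g \<in> borel_measurable M"
    and int: "integrable M (\<lambda>x. norm (f x) powr p)" "integrable M (\<lambda>x. norm (g x) powr p)"
    using assms by (auto simp: Lp_funs_def)
  have bound: "norm (f x - g x) powr p \<le> 2 powr p * (norm (f x) powr p + norm (g x) powr p)" for x
  proof -
    have "norm (f x - g x) \<le> 2 * max (norm (f x)) (norm (g x))"
      using norm_triangle_ineq4[of "f x" "g x"] by linarith
    then have "norm (f x - g x) powr p \<le> (2 * max (norm (f x)) (norm (g x))) powr p"
      using assms(3) by (intro powr_mono2) auto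
    also have "\<dots> = 2 powr p * max (norm (f x)) (norm (g x)) powr p"
      by (subst powr_mult) (auto simp: le_max_iff_disj)
    also have "max (norm (f x)) (norm (g x)) powr p \<le> norm (f x) powr p + norm (g x) powr p"
      by (auto simp: max_def)
    finally show ?thesis by simp
  qed
  have "integrable M (\<lambda>x. norm (f x - g x) powr p)"
  proof (rule Bochner_Integration.integrable_bound)
    show "integrable M (\<lambda>x. 2 powr p * (norm (f x) powr p + norm (g x) powr p))"
      using int by simp
    show "AE x in M. norm (norm (f x - g x) powr p)
        \<le> norm (2 powr p * (norm (f x) powr p + norm (g x) powr p))"
      using bound by (intro AE_I2) (simp add: order_trans[OF _ abs_ge_self])
  qed simp
  then show ?thesis by (simp add: Lp_funs_def)
qed

lemma Lp_norm_class:
  assumes "f \<in> Lp_funs M p"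
  shows "Lp_norm M p (Lp_rel M p `` {f}) = (\<integral>x. norm (f x) powr p \<partial>M) powr (1 / p)"
proof -
  let ?N = "\<lambda>f. (\<integral>x. norm (f x) powr p \<partial>M) powr (1 / p)"
  have "?N g = ?N f" if "(f, g) \<in> Lp_rel M p" for g
  proof -
    have [measurable]: "f \<in> borel_measurable M" "g \<in> borel_measurable M" and "AE x in M. f x = g x"
      using that by (simp_all add: Lp_rel_def Lp_funs_def)
    from \<open>AE x in M. f x = g x\<close> have "AE x in M. norm (g x) powr p = norm (f x) powr p"
      by eventually_elim simp
    then have "(\<integral>x. norm (g x) powr p \<partial>M) = (\<integral>x. norm (f x) powr p \<partial>M)"
      by (intro integral_cong_AE) simp_all
    then show ?thesis by simp
  qed
  moreover have "(f, f) \<in> Lp_rel M p"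
    using assms by (simp add: Lp_rel_def)
  ultimately have "?N ` (Lp_rel M p `` {f}) = {?N f}"
    unfolding Image_singleton by blast
  then show ?thesis by (simp add: Lp_norm_def)
qed

lemma Lp_minus_class:
  assumes "f \<in> Lp_funs M p" "g \<in> Lp_funs M p" "0 \<le> p"
  shows "Lp_minus M p (Lp_rel M p `` {f}) (Lp_rel M p `` {g}) = Lp_rel M p `` {\<lambda>x. f x - g x}"
proof -
  have "Lp_rel M p `` {\<lambda>x. f' x - g' x} = Lp_rel M p `` {\<lambda>x. f x - g x}"
    if "(f, f') \<in> Lp_rel M p" "(g, g') \<in> Lp_rel M p" for f' g'
  proof -
    have "AE x in M. f x = f' x" "AE x in M. g x = g' x"
      using that by (auto simp: Lp_rel_def)
    then have "AE x in M. f' x - g' x = f x - g x"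
      by eventually_elim simp
    moreover have "(\<lambda>x. f' x - g' x) \<in> Lp_funs M p"
      using that assms(3) by (intro Lp_funs_diff) (auto simp: Lp_rel_def)
    ultimately show ?thesis
      using assms by (intro equiv_class_eq[OF equiv_Lp_rel]) (auto simp: Lp_rel_def Lp_funs_diff)
  qed
  moreover have "(f, f) \<in> Lp_rel M p" "(g, g) \<in> Lp_rel M p"
    using assms by (auto simp: Lp_rel_def)
  ultimately show ?thesis
    unfolding Lp_minus_def by blast
qed

end

theory Submission
  imports Defs
begin

text \<open>
  Since \<open>T\<close> fixes the ball, every \<open>z\<close> in it satisfies \<open>\<parallel>T u - z\<parallel> \<le> \<parallel>u - z\<parallel>\<close>. The useful choice is
  \<open>z = q + t (u - T u)\<close> with \<open>t = r / (2 K)\<close>, for then all the points involved lie on one line.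
  Convexity of the \<open>p\<close>-th power of the norm on that line, together with Clarkson's inequality for
  the midpoint of \<open>u - q\<close> and \<open>T u - q\<close>, turns this into
  \<open>\<parallel>u - q\<parallel>\<^sup>p - \<parallel>T u - q\<parallel>\<^sup>p \<ge> 4 t (\<parallel>u - T u\<parallel> / 2)\<^sup>p\<close>. Along the orbit of \<open>x\<close> the left-hand sides telescope to
  at most \<open>K\<^sup>p\<close>, while the displacements do not increase.
\<close>

section \<open>Scalar and pointwise inequalities for \<open>p\<close>-th powers\<close>

lemma powr_convex_combination:
  fixes x y p t :: real
  assumes "p \<ge> 1" "x \<ge> 0" "y \<ge> 0" "0 \<le> t" "t \<le> 1"
  shows "((1 - t) * x + t * y) powr p \<le> (1 - t) * x powr p + t * y powr p"
proof -
  \<comment> \<open>Serves the case where \<open>x\<close> or \<open>y\<close> is 0: only one scaled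
    term survives, and \<open>s powr p \<le> s\<close> on the unit interval suffices.\<close>
  have scale: "(s * z) powr p \<le> s * z powr p" if "0 \<le> s" "s \<le> 1" "z \<ge> 0" for s z
  proof -
    have "s powr p \<le> s"
      using powr_mono'[of 1 p s] assms(1) that by (cases "s = 0") auto
    then show ?thesis
      using that by (simp add: powr_mult mult_right_mono)
  qed
  show ?thesis
  proof (cases "x > 0 \<and> y > 0")
    case True
    then show ?thesis
      using convex_onD[OF powr_convex[OF assms(1)], of t x y] assms by simp
  next
    case False
    then have "x = 0 \<or> y = 0" using assms by auto
    then show ?thesis
      using scale[of t y] scale[of "1 - t" x] assms by auto
  qed
qed

lemma norm_powr_convex_combination:
  fixes u v :: "'b::real_normed_vector"
  assumes "p \<ge> 1" "0 \<le> t" "t \<le> 1"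
  shows "norm ((1 - t) *\<^sub>R u + t *\<^sub>R v) powr p \<le> (1 - t) * norm u powr p + t * norm v powr p"
proof -
  have "norm ((1 - t) *\<^sub>R u + t *\<^sub>R v) \<le> (1 - t) * norm u + t * norm v"
    using norm_triangle_ineq[of "(1 - t) *\<^sub>R u" "t *\<^sub>R v"] assms by simp
  then have "norm ((1 - t) *\<^sub>R u + t *\<^sub>R v) powr p \<le> ((1 - t) * norm u + t * norm v) powr p"
    using assms by (intro powr_mono2) auto
  also have "\<dots> \<le> (1 - t) * norm u powr p + t * norm v powr p"
    using assms by (intro powr_convex_combination) auto
  finally show ?thesis .
qed

text \<open>Each \<open>z\<close> among the summands is at most \<open>x + y\<close>, so
  \<open>z powr s\<close> is at most \<open>z * (x + y) powr (s - 1)\<close>; adding the two bounds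
  gives the right-hand side.\<close>

lemma powr_superadditive:
  fixes x y s :: real
  assumes "s \<ge> 1" "x \<ge> 0" "y \<ge> 0"
  shows "x powr s + y powr s \<le> (x + y) powr s"
proof -
  have *: "z powr s \<le> z * (x + y) powr (s - 1)" if "0 \<le> z" "z \<le> x + y" for z
  proof (cases "z = 0")
    case False
    then have "z powr s = z * z powr (s - 1)"
      using that by (simp add: powr_mult_base)
    also have "\<dots> \<le> z * (x + y) powr (s - 1)"
      using that assms by (intro mult_left_mono powr_mono2) auto
    finally show ?thesis .
  qed simp
  have "x powr s + y powr s \<le> (x + y) * (x + y) powr (s - 1)"
    using *[of x] *[of y] assms by (simp add: distrib_right)
  then show ?thesis
    using assms by (simp add: powr_mult_base)
qed

text \<open>Written in terms of squared norms, the \<open>p\<close>-th power becomes a power with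
  exponent \<open>p / 2 \<ge> 1\<close>. Superadditivity of that power, the parallelogram law, and
  convexity of the same power then chain together.\<close>

lemma Clarkson_inequality:
  fixes u v :: "'b::real_inner"
  assumes "p \<ge> 2"
  shows "2 * (norm u powr p + norm v powr p) \<le> norm (u + v) powr p + norm (u - v) powr p"
proof -
  have sq: "norm w powr p = (norm w ^ 2) powr (p / 2)" for w :: 'b
    by (cases "w = 0") (simp_all add: powr_powr flip: powr_numeral)
  have par: "norm u ^ 2 + norm v ^ 2 = (norm (u + v) ^ 2 + norm (u - v) ^ 2) / 2"
    by (simp add: power2_norm_eq_inner inner_add inner_diff inner_commute)
  have "norm u powr p + norm v powr p \<le> (norm u ^ 2 + norm v ^ 2) powr (p / 2)"
    unfolding sq using assms by (intro powr_superadditive) auto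
  also have "\<dots> \<le> (norm (u + v) powr p + norm (u - v) powr p) / 2"
    using powr_convex_combination[of "p / 2" "norm (u + v) ^ 2" "norm (u - v) ^ 2" "1 / 2"] assms
    unfolding par sq by (simp add: field_simps)
  finally show ?thesis by simp
qed

text \<open>Read \<open>a\<close> as \<open>u - q\<close>, \<open>b\<close> as
  \<open>T u - q\<close> and \<open>t (a - b)\<close> as \<open>z - q\<close>. On the line through
  \<open>a\<close> and \<open>b\<close> with midpoint \<open>m\<close>, the bound
  \<open>t \<le> 1 / 2\<close> puts \<open>a - t (a - b)\<close> between \<open>a\<close> and
  \<open>m\<close>, while \<open>b\<close> lies between \<open>m\<close> and
  \<open>b - t (a - b)\<close>. Convexity on these two segments leaves terms in \<open>m\<close>,
  which Clarkson's inequality removes.\<close>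

lemma norm_powr_extrapolation:
  fixes a b :: "'b::real_inner"
  assumes "p \<ge> 2" "0 \<le> t" "t \<le> 1 / 2"
  shows "norm b powr p + 4 * t * (norm (a - b) / 2) powr p + norm (a - t *\<^sub>R (a - b)) powr p
    \<le> norm a powr p + norm (b - t *\<^sub>R (a - b)) powr p"
proof -
  define m where "m = (1 / 2) *\<^sub>R (a + b)"
  \<comment> \<open>The weight of \<open>m\<close> when \<open>b\<close> is a convex combination of
    \<open>b - t (a - b)\<close> and \<open>m\<close>.\<close>
  define s where "s = 2 * t / (1 + 2 * t)"
  have s: "0 \<le> s" "s \<le> 1" "1 - s = 1 / (1 + 2 * t)"
    using assms by (auto simp: s_def field_simps)
  have tm: "(2 * t) *\<^sub>R m = t *\<^sub>R (a + b)"
    by (simp add: m_def)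
  have two: "(2 * t) *\<^sub>R w = t *\<^sub>R w + t *\<^sub>R w" for w :: 'b
    by (metis mult_2 scaleR_add_left)
  have "a - t *\<^sub>R (a - b) = (1 - 2 * t) *\<^sub>R a + (2 * t) *\<^sub>R m"
    unfolding tm scaleR_diff_left scaleR_add_left two[of a] two[of b] by (simp add: algebra_simps)
  then have upper: "norm (a - t *\<^sub>R (a - b)) powr p \<le> (1 - 2 * t) * norm a powr p + 2 * t * norm m powr p"
    using norm_powr_convex_combination[of p "2 * t" a m] assms by simp
  have "(1 + 2 * t) *\<^sub>R b = (b - t *\<^sub>R (a - b)) + (2 * t) *\<^sub>R m"
    unfolding tm scaleR_diff_left scaleR_add_left two[of a] two[of b] by (simp add: algebra_simps)
  then have "b = (1 / (1 + 2 * t)) *\<^sub>R ((b - t *\<^sub>R (a - b)) + (2 * t) *\<^sub>R m)"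
    using assms by (simp flip: \<open>(1 + 2 * t) *\<^sub>R b = _\<close>)
  then have "b = (1 - s) *\<^sub>R (b - t *\<^sub>R (a - b)) + s *\<^sub>R m"
    unfolding s(3) by (simp add: s_def scaleR_add_right)
  then have "norm b powr p \<le> (1 - s) * norm (b - t *\<^sub>R (a - b)) powr p + s * norm m powr p"
    using norm_powr_convex_combination[of p s "b - t *\<^sub>R (a - b)" m] assms s by simp
  also have "\<dots> = (norm (b - t *\<^sub>R (a - b)) powr p + 2 * t * norm m powr p) / (1 + 2 * t)"
    unfolding s(3) by (simp add: s_def add_divide_distrib)
  finally have lower: "(1 + 2 * t) * norm b powr p \<le> norm (b - t *\<^sub>R (a - b)) powr p + 2 * t * norm m powr p"
    using assms by (simp add: field_simps)
  \<comment> \<open>Clarkson's inequality for \<open>m\<close> and half of \<open>a - b\<close>,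
    multiplied by \<open>2 * t\<close>, absorbs the total \<open>4 * t * norm m powr p\<close>
    coming from \<open>upper\<close> and \<open>lower\<close>.\<close>
  have "m + (1 / 2) *\<^sub>R (a - b) = a" "norm (m - (1 / 2) *\<^sub>R (a - b)) = norm b"
    by (simp_all add: m_def algebra_simps flip: scaleR_add_left)
  then have "2 * (norm m powr p + (norm (a - b) / 2) powr p) \<le> norm a powr p + norm b powr p"
    using Clarkson_inequality[OF assms(1), of m "(1 / 2) *\<^sub>R (a - b)"] by simp
  then have "(2 * t) * (2 * (norm m powr p + (norm (a - b) / 2) powr p))
      \<le> (2 * t) * (norm a powr p + norm b powr p)"
    using assms by (intro mult_left_mono) auto
  with upper lower show ?thesis
    by (simp add: algebra_simps)
qed


section \<open>Distances in \<open>Lp\<close> through representatives\<close>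

lemma Lp_funs_scaleR:
  assumes "f \<in> Lp_funs M p" "0 \<le> c"
  shows "(\<lambda>x. c *\<^sub>R f x) \<in> Lp_funs M p"
  using assms by (auto simp: Lp_funs_def powr_mult)

lemma Lp_norm_minus_nonneg:
  assumes "u \<in> Lp M p" "v \<in> Lp M p" "0 \<le> p"
  shows "Lp_norm M p (Lp_minus M p u v) \<ge> 0"
  using assms by (auto simp: Lp_def quotient_def Lp_minus_class Lp_norm_class Lp_funs_diff
      simp del: Image_singleton_iff)

lemma Lp_norm_minus_self:
  assumes "u \<in> Lp M p" "0 < p"
  shows "Lp_norm M p (Lp_minus M p u u) = 0"
proof -
  obtain f where f: "f \<in> Lp_funs M p" "u = Lp_rel M p `` {f}"
    using assms by (auto simp: Lp_def elim!: quotientE)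
  then have "Lp_norm M p (Lp_minus M p u u) = (\<integral>x. norm (f x - f x) powr p \<partial>M) powr (1 / p)"
    using assms by (simp only: Lp_minus_class Lp_norm_class Lp_funs_diff less_imp_le)
  then show ?thesis
    using assms by simp
qed

lemma Lp_norm_minus_commute:
  assumes "u \<in> Lp M p" "v \<in> Lp M p" "0 \<le> p"
  shows "Lp_norm M p (Lp_minus M p u v) = Lp_norm M p (Lp_minus M p v u)"
  using assms by (auto simp: Lp_def quotient_def Lp_minus_class Lp_norm_class Lp_funs_diff
      norm_minus_commute)

lemma Lp_norm_minus_powr:
  assumes "f \<in> Lp_funs M p" "g \<in> Lp_funs M p" "0 < p"
  shows "Lp_norm M p (Lp_minus M p (Lp_rel M p `` {f}) (Lp_rel M p `` {g})) powr p
    = (\<integral>x. norm (f x - g x) powr p \<partial>M)"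
  using assms by (simp add: Lp_minus_class Lp_norm_class Lp_funs_diff powr_powr)

text \<open>Pointwise convexity at the midpoint of \<open>f - h\<close> and \<open>h - g\<close>,
  integrated. It stands in for the triangle inequality: if \<open>u\<close> and \<open>v\<close> are
  within \<open>K\<close> of \<open>q\<close>, then their distance is at most
  \<open>2 * K\<close>.\<close>

lemma Lp_norm_midpoint_convex:
  assumes "1 \<le> p" "u \<in> Lp M p" "v \<in> Lp M p" "q \<in> Lp M p"
  shows "(Lp_norm M p (Lp_minus M p u v) / 2) powr p
    \<le> (Lp_norm M p (Lp_minus M p u q) powr p + Lp_norm M p (Lp_minus M p v q) powr p) / 2"
proof -
  obtain f g h where fgh: "f \<in> Lp_funs M p" "g \<in> Lp_funs M p" "h \<in> Lp_funs M p"
    and uvq: "u = Lp_rel M p `` {f}" "v = Lp_rel M p `` {g}" "q = Lp_rel M p `` {h}"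
    using assms by (auto simp: Lp_def elim!: quotientE)
  have int: "integrable M (\<lambda>x. norm (f x - g x) powr p)" "integrable M (\<lambda>x. norm (f x - h x) powr p)"
    "integrable M (\<lambda>x. norm (g x - h x) powr p)"
    using Lp_funs_diff[of _ M p] fgh assms(1) by (auto simp: Lp_funs_def)
  have pw: "norm (f x - g x) powr p / 2 powr p
      \<le> (norm (f x - h x) powr p + norm (g x - h x) powr p) / 2" for x
    using norm_powr_convex_combination[of p "1 / 2" "f x - h x" "h x - g x"] assms(1)
    by (simp add: norm_minus_commute powr_divide add_divide_distrib flip: scaleR_add_right)
  have "(\<integral>x. norm (f x - g x) powr p / 2 powr p \<partial>M)
      \<le> (\<integral>x. (norm (f x - h x) powr p + norm (g x - h x) powr p) / 2 \<partial>M)"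
    using int pw by (intro integral_mono) auto
  then show ?thesis
    using int assms fgh Lp_norm_minus_nonneg[of _ M p]
    by (simp add: powr_divide Lp_norm_minus_powr uvq)
qed

text \<open>The integrated form of \<open>norm_powr_extrapolation\<close>; the witness
  \<open>z\<close> is the class of \<open>q + t (u - v)\<close>.\<close>

lemma Lp_norm_extrapolation:
  assumes "2 \<le> p" "0 \<le> t" "t \<le> 1 / 2" "u \<in> Lp M p" "v \<in> Lp M p" "q \<in> Lp M p"
  obtains z where "z \<in> Lp M p"
    "Lp_norm M p (Lp_minus M p z q) = t * Lp_norm M p (Lp_minus M p u v)"
    "Lp_norm M p (Lp_minus M p v q) powr p + 4 * t * (Lp_norm M p (Lp_minus M p u v) / 2) powr p
        + Lp_norm M p (Lp_minus M p u z) powr p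
      \<le> Lp_norm M p (Lp_minus M p u q) powr p + Lp_norm M p (Lp_minus M p v z) powr p"
proof -
  obtain f g h where fgh: "f \<in> Lp_funs M p" "g \<in> Lp_funs M p" "h \<in> Lp_funs M p"
    and uvq: "u = Lp_rel M p `` {f}" "v = Lp_rel M p `` {g}" "q = Lp_rel M p `` {h}"
    using assms by (auto simp: Lp_def elim!: quotientE)
  \<comment> \<open>This is \<open>h + t (f - g)\<close>, written as a difference with a nonnegative
    multiple so that \<open>Lp_funs_diff\<close> and \<open>Lp_funs_scaleR\<close> apply.\<close>
  define k where "k = (\<lambda>x. h x - t *\<^sub>R (g x - f x))"
  have k: "k \<in> Lp_funs M p"
    unfolding k_def using assms fgh by (intro Lp_funs_diff Lp_funs_scaleR) auto
  define z where "z = Lp_rel M p `` {k}"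
  have "z \<in> Lp M p"
    unfolding z_def Lp_def using k by (rule quotientI)
  moreover have "Lp_norm M p (Lp_minus M p z q) = t * Lp_norm M p (Lp_minus M p u v)"
  proof -
    have "norm (k x - h x) powr p = t powr p * norm (f x - g x) powr p" for x
      using assms by (simp add: k_def powr_mult norm_minus_commute)
    then show ?thesis
      using assms fgh k unfolding z_def uvq
      by (simp add: Lp_minus_class Lp_norm_class Lp_funs_diff powr_mult powr_powr)
  qed
  moreover have "Lp_norm M p (Lp_minus M p v q) powr p
      + 4 * t * (Lp_norm M p (Lp_minus M p u v) / 2) powr p + Lp_norm M p (Lp_minus M p u z) powr p
      \<le> Lp_norm M p (Lp_minus M p u q) powr p + Lp_norm M p (Lp_minus M p v z) powr p"
  proof -
    have int: "integrable M (\<lambda>x. norm (f x - g x) powr p)" "integrable M (\<lambda>x. norm (f x - h x) powr p)"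
      "integrable M (\<lambda>x. norm (g x - h x) powr p)" "integrable M (\<lambda>x. norm (f x - k x) powr p)"
      "integrable M (\<lambda>x. norm (g x - k x) powr p)"
      using Lp_funs_diff[of _ M p] fgh k assms(1) by (auto simp: Lp_funs_def)
    have pw: "norm (g x - h x) powr p + 4 * t * (norm (f x - g x) powr p / 2 powr p)
        + norm (f x - k x) powr p \<le> norm (f x - h x) powr p + norm (g x - k x) powr p" for x
    proof -
      have eq: "f x - k x = (f x - h x) - t *\<^sub>R ((f x - h x) - (g x - h x))"
        "g x - k x = (g x - h x) - t *\<^sub>R ((f x - h x) - (g x - h x))"
        by (simp_all add: k_def algebra_simps)
      show ?thesis
        using norm_powr_extrapolation[OF assms(1-3), of "g x - h x" "f x - h x"]
        unfolding eq by (simp add: powr_divide)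
    qed
    have "(\<integral>x. norm (g x - h x) powr p + 4 * t * (norm (f x - g x) powr p / 2 powr p)
          + norm (f x - k x) powr p \<partial>M)
        \<le> (\<integral>x. norm (f x - h x) powr p + norm (g x - k x) powr p \<partial>M)"
      using int pw by (intro integral_mono) auto
    then show ?thesis
      using int assms fgh k Lp_norm_minus_nonneg[of _ M p]
      by (simp add: powr_divide Lp_norm_minus_powr uvq z_def)
  qed
  ultimately show thesis
    by (rule that)
qed

text \<open>Applied with \<open>v = T u\<close>, where \<open>nearer\<close> follows from
  nonexpansiveness because \<open>T\<close> fixes the ball. At the extrapolated \<open>z\<close> it
  cancels the two distances to \<open>z\<close>, leaving the gain \<open>4 * t = 2 * r / K\<close>
  times the displacement term.\<close>

lemma displacement_powr_le_descent:
  fixes M :: "'a measure" and p r K :: real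
    and u v q :: "('a \<Rightarrow> 'b::{real_normed_field, euclidean_space}) set"
  defines "D \<equiv> \<lambda>u v. Lp_norm M p (Lp_minus M p u v)"
  assumes "2 \<le> p" "0 < r" "r \<le> K" "u \<in> Lp M p" "v \<in> Lp M p" "q \<in> Lp M p"
    and "D u q \<le> K" "D v q \<le> K"
    and nearer: "\<And>z. z \<in> Lp_cball M p q r \<Longrightarrow> D v z \<le> D u z"
  shows "2 * r / K * (D u v / 2) powr p \<le> D u q powr p - D v q powr p"
proof -
  have nn: "D w w' \<ge> 0" if "w \<in> Lp M p" "w' \<in> Lp M p" for w w'
    unfolding D_def using that assms by (intro Lp_norm_minus_nonneg) auto
  \<comment> \<open>The resulting bound \<open>D u v \<le> 2 * K\<close> is what keeps
    \<open>z\<close> in the ball for \<open>t = r / (2 * K)\<close>; \<open>r \<le> K\<close> makes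
    this \<open>t\<close> at most \<open>1 / 2\<close>.\<close>
  have "(D u v / 2) powr p \<le> (D u q powr p + D v q powr p) / 2"
    unfolding D_def using assms by (intro Lp_norm_midpoint_convex) auto
  also have "\<dots> \<le> K powr p"
    using powr_mono2[of p "D u q" K] powr_mono2[of p "D v q" K] nn assms by simp
  finally have "D u v / 2 \<le> K"
    using powr_less_mono2[of p K "D u v / 2"] assms by (smt (verit))
  then have tr: "r / (2 * K) * D u v \<le> r"
    using assms by (simp add: field_simps)
  have "r / (2 * K) \<le> 1 / 2" "0 \<le> r / (2 * K)"
    using assms by (auto simp: field_simps)
  then obtain z where z: "z \<in> Lp M p" "D z q = r / (2 * K) * D u v"
    "D v q powr p + 4 * (r / (2 * K)) * (D u v / 2) powr p + D u z powr p \<le> D u q powr p + D v z powr p"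
    using Lp_norm_extrapolation[of p "r / (2 * K)" u M v q] assms unfolding D_def by metis
  have "z \<in> Lp_cball M p q r"
    using z(1,2) tr by (simp add: Lp_cball_def D_def)
  then have "D v z powr p \<le> D u z powr p"
    using nearer nn z(1) assms by (intro powr_mono2) auto
  then show ?thesis
    using z(3) by simp
qed

section \<open>Telescoping along the orbit and the explicit rate\<close>

theorem theorem6p1:
  fixes M :: "'a measure" and p r K :: real
    and C :: "('a \<Rightarrow> 'b::{real_normed_field, euclidean_space}) set set"
    and T :: "('a \<Rightarrow> 'b) set \<Rightarrow> ('a \<Rightarrow> 'b) set"
    and q x :: "('a \<Rightarrow> 'b) set"
  assumes "2 \<le> p"
    and "C \<subseteq> Lp M p"
    and "T ` C \<subseteq> C"
    and "nonexpansive_on M p C T"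
    and "q \<in> Lp M p" and "r > 0"
    and "Lp_cball M p q r \<subseteq> Fix_on C T"
    and "x \<in> C"
    and "Lp_norm M p (Lp_minus M p x q) < K"
  shows "\<forall>\<epsilon>::real. \<epsilon> > 0 \<longrightarrow>
    (\<forall>i::nat. int i \<ge> \<lceil>p * 2 powr (3 * p + 1) * K powr (p + 2) / (\<epsilon> powr p * r\<^sup>2)\<rceil> \<longrightarrow>
       Lp_norm M p (Lp_minus M p ((T ^^ (i + 1)) x) ((T ^^ i) x)) \<le> \<epsilon>)"
proof (intro allI impI)
  fix \<epsilon> :: real and i :: nat
  assume "\<epsilon> > 0"
    and i: "int i \<ge> \<lceil>p * 2 powr (3 * p + 1) * K powr (p + 2) / (\<epsilon> powr p * r\<^sup>2)\<rceil>"
  define D where "D = (\<lambda>u v :: ('a \<Rightarrow> 'b) set. Lp_norm M p (Lp_minus M p u v))"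
  have TC: "T u \<in> C" if "u \<in> C" for u
    using that assms by auto
  have iter: "(T ^^ n) x \<in> C" for n
    using assms TC by (induction n) auto
  have C_Lp: "u \<in> Lp M p" if "u \<in> C" for u
    using that assms by auto
  have nonexp: "D (T u) (T v) \<le> D u v" if "u \<in> C" "v \<in> C" for u v
    using that assms by (simp add: nonexpansive_on_def D_def)
  have nn: "D u v \<ge> 0" if "u \<in> C" "v \<in> C" for u v
    unfolding D_def using that C_Lp assms by (intro Lp_norm_minus_nonneg) auto
  have self: "D u u = 0" if "u \<in> Lp M p" for u
    unfolding D_def using that assms by (intro Lp_norm_minus_self) auto
  have comm: "D u v = D v u" if "u \<in> C" "v \<in> C" for u v
    unfolding D_def using that C_Lp assms by (intro Lp_norm_minus_commute) auto
  have fix_ball: "z \<in> C" "T z = z" if "z \<in> Lp_cball M p q r" for z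
    using that assms by (auto simp: Fix_on_def)
  have "q \<in> Lp_cball M p q r"
    using self assms by (simp add: Lp_cball_def D_def)
  note q = fix_ball[OF this]
  have "D ((T ^^ (i + 1)) x) ((T ^^ i) x) \<le> \<epsilon>"
  \<comment> \<open>If \<open>K < r\<close>, then \<open>x\<close> itself lies in the ball, so its
    orbit is constant. Otherwise the descent lemma applies.\<close>
  proof (cases "r \<le> K")
    case False
    then have "x \<in> Lp_cball M p q r"
      using assms by (auto simp: Lp_cball_def)
    then have "(T ^^ n) x = x" for n
      using fix_ball(2) by (induction n) auto
    then show "D ((T ^^ (i + 1)) x) ((T ^^ i) x) \<le> \<epsilon>"
      using self[OF C_Lp[OF \<open>x \<in> C\<close>]] \<open>\<epsilon> > 0\<close> by (simp del: funpow.simps)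
  next
    case True
    have "K > 0" using True assms by simp
    have dist: "D ((T ^^ n) x) q \<le> K" for n
    proof (induction n)
      case (Suc n)
      then show ?case
        using nonexp[OF iter[of n] q(1)] q by simp
    qed (use assms in \<open>simp add: D_def\<close>)
    have descent: "2 * r / K * (D ((T ^^ n) x) ((T ^^ Suc n) x) / 2) powr p
        \<le> D ((T ^^ n) x) q powr p - D ((T ^^ Suc n) x) q powr p" for n
      unfolding D_def
    proof (rule displacement_powr_le_descent[OF \<open>2 \<le> p\<close> \<open>r > 0\<close> True])
      fix z assume "z \<in> Lp_cball M p q r"
      with fix_ball[OF this] nonexp[OF iter[of n], of z]
      show "Lp_norm M p (Lp_minus M p ((T ^^ Suc n) x) z) \<le> Lp_norm M p (Lp_minus M p ((T ^^ n) x) z)"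
        by (simp add: D_def)
    qed (use iter[of n] iter[of "Suc n"] C_Lp assms dist[of n] dist[of "Suc n"] in \<open>auto simp: D_def\<close>)
    define \<delta> where "\<delta> = D ((T ^^ (i + 1)) x) ((T ^^ i) x)"
    have "\<delta> \<ge> 0"
      unfolding \<delta>_def using iter by (intro nn)
    \<comment> \<open>Displacements do not increase, so the one at index \<open>i\<close>, namely
      \<open>\<delta>\<close>, bounds all earlier ones from below.\<close>
    have dec: "D ((T ^^ Suc (Suc n)) x) ((T ^^ Suc n) x) \<le> D ((T ^^ Suc n) x) ((T ^^ n) x)" for n
      using nonexp[OF iter[of "Suc n"] iter[of n]] by simp
    have "\<delta> \<le> D ((T ^^ n) x) ((T ^^ Suc n) x)" if "n \<le> i" for n
      using lift_Suc_antimono_le[of "\<lambda>n. D ((T ^^ Suc n) x) ((T ^^ n) x)", OF dec that]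
        comm[OF iter[of n] iter[of "Suc n"]] by (simp add: \<delta>_def)
    then have "2 * r / K * (\<delta> / 2) powr p \<le> D ((T ^^ n) x) q powr p - D ((T ^^ Suc n) x) q powr p"
      if "n \<le> i" for n
      using that \<open>\<delta> \<ge> 0\<close> \<open>K > 0\<close> assms(1,6)
      by (intro order_trans[OF _ descent] mult_left_mono powr_mono2 divide_right_mono) auto
    \<comment> \<open>There are \<open>i + 1\<close> summands, for the indices 0 to
      \<open>i\<close>.\<close>
    then have "(\<Sum>n<Suc i. 2 * r / K * (\<delta> / 2) powr p)
        \<le> (\<Sum>n<Suc i. D ((T ^^ n) x) q powr p - D ((T ^^ Suc n) x) q powr p)"
      by (intro sum_mono) auto
    also have "\<dots> = D x q powr p - D ((T ^^ Suc i) x) q powr p"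
      by (subst sum_lessThan_telescope') simp
    also have "\<dots> \<le> D x q powr p"
      by simp
    also have "\<dots> \<le> K powr p"
      using assms nn[of x q] q by (intro powr_mono2) (auto simp: D_def)
    finally have total: "real (Suc i) * (2 * r / K * (\<delta> / 2) powr p) \<le> K powr p"
      by simp
    show "D ((T ^^ (i + 1)) x) ((T ^^ i) x) \<le> \<epsilon>"
      unfolding \<delta>_def[symmetric]
    proof (rule ccontr)
      assume "\<not> \<delta> \<le> \<epsilon>"
      \<comment> \<open>Multiplying the rate by \<open>2 * r / K * (\<epsilon> / 2) powr p\<close>
        gives \<open>K powr p\<close> times \<open>p * 2 powr (2 * p) * (4 * (K / r))\<close>. That
        factor is at least 1, so the rate suffices.\<close>
      have "1 \<le> p * 2 powr (2 * p)"
        using assms(1) mult_mono[of 1 p 1 "2 powr (2 * p)"] by (simp add: ge_one_powr_ge_zero)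
      moreover have "1 \<le> 4 * (K / r)"
        using True assms by (simp add: field_simps)
      ultimately have "1 \<le> p * 2 powr (2 * p) * (4 * (K / r))"
        using mult_mono[of 1 "p * 2 powr (2 * p)" 1 "4 * (K / r)"] by simp
      then have "K powr p \<le> K powr p * (p * 2 powr (2 * p) * (4 * (K / r)))"
        by (metis mult_left_mono mult.right_neutral powr_ge_zero)
      also have "\<dots> = p * 2 powr (3 * p + 1) * K powr (p + 2) / (\<epsilon> powr p * r\<^sup>2) * (2 * r / K * (\<epsilon> / 2) powr p)"
      proof -
        have "(2::real) powr (3 * p + 1) = 2 powr (2 * p) * 2 powr p * 2"
          using powr_add[of 2 "2 * p" p] powr_add[of 2 "3 * p" 1] by simp
        moreover have "K powr (p + 2) = K powr p * K\<^sup>2"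
          using \<open>K > 0\<close> by (simp add: powr_add)
        ultimately show ?thesis
          using \<open>K > 0\<close> \<open>\<epsilon> > 0\<close> \<open>r > 0\<close> by (simp add: powr_divide field_simps power2_eq_square)
      qed
      also have "\<dots> \<le> real i * (2 * r / K * (\<epsilon> / 2) powr p)"
        using i \<open>K > 0\<close> assms by (intro mult_right_mono) (auto simp: ceiling_le_iff)
      also have "\<dots> \<le> real i * (2 * r / K * (\<delta> / 2) powr p)"
        using \<open>\<not> \<delta> \<le> \<epsilon>\<close> \<open>\<epsilon> > 0\<close> \<open>K > 0\<close> assms by (intro mult_left_mono powr_mono2) auto
      \<comment> \<open>The summand beyond \<open>i\<close> supplies the strict inequality that
        contradicts \<open>total\<close>.\<close>
      also have "\<dots> < real (Suc i) * (2 * r / K * (\<delta> / 2) powr p)"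
        using \<open>\<not> \<delta> \<le> \<epsilon>\<close> \<open>\<epsilon> > 0\<close> \<open>K > 0\<close> assms by (intro mult_strict_right_mono) auto
      finally show False
        using total by simp
    qed
  qed
  then show "Lp_norm M p (Lp_minus M p ((T ^^ (i + 1)) x) ((T ^^ i) x)) \<le> \<epsilon>"
    by (simp add: D_def)
qed

end
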